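(* Let $(\mathbf{EF})$, the subproblem value $\mathbb{Q}(\bm{y}^0,\omega)$ and the recourse function $\mathbb{L}(\bm{y}^0)=\frac{1}{|\Omega|}\sum_{\omega\in\Omega}\mathbb{Q}(\bm{y}^0,\omega)$ be as defined in the context. Let $L\in\mathbb{R}$ be a lower bound on the recourse function, i.e. $L\le \mathbb{L}(\bm{y}^0)$ for every first-stage feasible $\bm{y}^0$. Let $\bm{y}^{0,\eta}\in\{0,1\}^M$ be any first-stage feasible binary vector and put $S^\eta=\{m\in M: y^{0,\eta}_m=1\}$. Then the inequality $$\theta \;\ge\; (\mathbb{L}(\bm{y}^{0,\eta})-L)\Big(\sum_{m\in S^\eta} y^0_m-\sum_{m\in M\setminus S^\eta} y^0_m\Big)-(\mathbb{L}(\bm{y}^{0,\eta})-L)(|S^\eta|-1)+L$$ in the variables $(\bm{y}^0,\theta)$ is a valid optimality cut for the problem $(\mathbf{EF})$; that is, for every optimal solution of $(\mathbf{EF})$ with order-selection component $\bm{y}^{0,*}$, the pair $(\bm{y}^0,\theta)=(\bm{y}^{0,*},\mathbb{L}(\bm{y}^{0,*}))$ satisfies the inequality.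
   Context: **Data.** $M$ is a finite set of existing requests, $N$ a finite set of potential future requests, $K=\{1,\dots,|K|\}$ a set of drones, $\mathcal{T}=\{1,\dots,T\}$ the future delivery cycles ($t=0$ is the current cycle, and $T+1$ is an ad-hoc cycle collecting all orders not delivered within the horizon), and $\Omega$ a finite set of scenarios. $O$ and $D$ are two aliases of the depot (start and end of tours). The arc sets are $A=\{(i,j): i\in M\cup\{O\}, j\in M\cup\{D\}, i\ne j\}\setminus\{(O,D)\}$ and $\tilde A=\{(i,j): i\in M\cup N\cup\{O\}, j\in M\cup N\cup\{D\}, i\neq j\}\setminus\{(O,D)\}$; sums and constraints involving $x_{ij}$ range over pairs in the relevant arc set. $Q$ is the load capacity and $E$ the battery capacity of a drone, and $P(u)$ is the energy consumption per unit distance at load $u$. $q_m$ is the weight of request $m\in M$; $q_j^\omega$ is the weight in scenario $\omega$ ($q_m^\omega=q_m$ for $m\in M$); $q_D=q_D^\omega=0$. $d_{ij}$ and $d_{ij}^\omega$ are distances ($d^\omega_{ij}=d_{ij}$ when $i,j\in M\cup\{O,D\}$). A negative value of $d_{On}^\omega$ encodes that request $n\in N$ is invalid (absent) in scenario $\omega$. $c_m^t$ and $c_n^{t,\omega}$ are penalties for handling a request in cycle $t$; $a_n^\omega$ is the first decision epoch following the arrival of $n\in N$. $\mathcal{M}$ is a sufficiently large constant, and $\alpha,\beta,\gamma,\kappa$ are cost coefficients. **First-stage constraints.** Variables: $x^{0,k}_{ij},y^0_m,r^{0,k}\in\{0,1\}$ and $u_i^{0,k},v_i^{0,k}\ge 0$.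 (1) $r^{0,k}=\sum_{m\in M}x_{Om}^{0,k}$ for all $k\in K$; (2) $r^{0,k}\le r^{0,k-1}$ for all $k\in K\setminus\{1\}$; (3) $y_m^0=\sum_{k\in K}\sum_{j\in M\cup\{D\}}x_{mj}^{0,k}$ for all $m\in M$; (4) $\sum_{i\in M\cup\{O\}}x_{im}^{0,k}=\sum_{j\in M\cup\{D\}}x_{mj}^{0,k}$ for all $m\in M$, $k\in K$; (5) $u_j^{0,k}\le u_i^{0,k}-q_j+Q(1-x_{ij}^{0,k})$ for all $(i,j)\in A$, $k\in K$; (6) $u_O^{0,k}\le Q$ and $u_D^{0,k}=0$ for all $k\in K$; (7) $v_j^{0,k}\le v_i^{0,k}-P(u_i^{0,k})d_{ij}+E(1-x_{ij}^{0,k})$ for all $(i,j)\in A$, $k\in K$; (8) $v_O^{0,k}=E$ and $v_D^{0,k}\ge0$ for all $k\in K$. A vector $\bm{y}^0\in\{0,1\}^M$ is *first-stage feasible* if it can be completed to a solution of (1)–(8). **Subproblem.** For $\bm{y}^0\in\{0,1\}^M$ and $\omega\in\Omega$, $\mathbb{Q}(\bm{y}^0,\omega)$ is the minimum, over binary $x_{ij}^{t,k,\omega},y_m^{t,\omega},y_n^{t,\omega},z_n^\omega,r^{t,k,\omega}$ and nonnegative real $u_i^{t,k,\omega},v_i^{t,k,\omega}$, of $$\alpha\sum_{t\in\mathcal{T}\cup\{T+1\}}\Big(\sum_{m\in M}c_m^ty_m^{t,\omega}+\sum_{n\in N}c_n^{t,\omega}y_n^{t,\omega}\Big)+\sum_{t\in\mathcal{T}}\Big(\beta\sum_{(i,j)\in\tilde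 A}d_{ij}^\omega\sum_{k\in K}x_{ij}^{t,k,\omega}+\gamma\sum_{k\in K}(v_O^{t,k,\omega}-v_D^{t,k,\omega})+\kappa\sum_{k\in K}r^{t,k,\omega}\Big)$$ subject to (for all $t\in\mathcal{T}$, $k\in K$ unless stated otherwise): $y_m^0+\sum_{t\in\mathcal{T}\cup\{T+1\}}y_m^{t,\omega}=1$ for $m\in M$; $\sum_{t\in\mathcal{T}\cup\{T+1\}}y_n^{t,\omega}=1$ for $n\in N$; $\mathcal{M}(1-y_n^{t,\omega})\ge a_n^\omega-t$ for $n\in N$, $t\in\mathcal{T}\cup\{T+1\}$; $y_m^{t,\omega}=\sum_{k\in K}\sum_{j\in M\cup N\cup\{D\}}x_{mj}^{t,k,\omega}$ for $m\in M$; $y_n^{t,\omega}=\sum_{k\in K}\sum_{j\in M\cup N\cup\{D\}}x_{nj}^{t,k,\omega}+z_n^\omega\mathbf{1}(a_n^\omega=t)$ for $n\in N$; $-\mathcal{M}z_n^\omega\le d_{On}^\omega\le\mathcal{M}(1-z_n^\omega)$ for $n\in N$; $r^{t,k,\omega}=\sum_{j\in M\cup N}x_{Oj}^{t,k,\omega}$; $r^{t,k,\omega}\le r^{t,k-1,\omega}$ for $k\neq1$; $\sum_{i\in M\cup N\cup\{O\}}x_{ih}^{t,k,\omega}=\sum_{j\in M\cup N\cup\{D\}}x_{hj}^{t,k,\omega}$ for $h\in M\cup N$; $u_j^{t,k,\omega}\le u_i^{t,k,\omega}-q_j^\omega+Q(1-x_{ij}^{t,k,\omega})$ for $(i,j)\in\tilde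 A$; $u_O^{t,k,\omega}\le Q$, $u_D^{t,k,\omega}=0$; $v_j^{t,k,\omega}\le v_i^{t,k,\omega}-P(u_i^{t,k,\omega})d_{ij}^\omega+E(1-x_{ij}^{t,k,\omega})$ for $(i,j)\in\tilde A$; $v_O^{t,k,\omega}=E$, $v_D^{t,k,\omega}\ge0$. The subproblem is assumed feasible for every first-stage feasible $\bm{y}^0$. **Problem (EF).** Minimize, over first-stage variables satisfying (1)–(8) and, for each $\omega\in\Omega$, second-stage variables satisfying the subproblem constraints, $$\alpha\sum_{m\in M}c_m^0y_m^0+\beta\sum_{(i,j)\in A}d_{ij}\sum_{k\in K}x_{ij}^{0,k}+\gamma\sum_{k\in K}(v_O^{0,k}-v_D^{0,k})+\kappa\sum_{k\in K}r^{0,k}$$ plus $\frac1{|\Omega|}$ times the sum over $\omega\in\Omega$ of the subproblem objectives. Equivalently, minimize the displayed first-stage cost plus $\mathbb{L}(\bm{y}^0)$ subject to (1)–(8). **Valid optimality cut**: an inequality in $(\bm{y}^0,\theta)$ that does not exclude the optimal solution $(\bm{y}^{0,*},\mathbb{L}(\bm{y}^{0,*}))$. *)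

theory Defs
  imports Complex_Main
begin

text \<open>Depot aliases are separate nodes: tours start in \<open>Orig\<close> and end in \<open>Dest\<close>.\<close>

datatype 'r node = Orig | Dest | Req 'r

text \<open>Drones are \<open>1, \<dots>, num_drones\<close> and future cycles are \<open>1, \<dots>, horizon\<close>;
  cycle \<open>0\<close> is the current one and \<open>horizon + 1\<close> the ad-hoc one. The fields ending in
  \<open>_scen\<close> are the scenario-dependent versions of the data. Weights are indexed by nodes since the
  load constraints also refer to the weight of \<open>Dest\<close>.\<close>

record ('r, 'w) drone_data =
  existing :: "'r set"
  potential :: "'r set"
  num_drones :: nat
  horizon :: nat
  scenarios :: "'w set"
  load_cap :: real
  battery_cap :: real
  energy_rate :: "real \<Rightarrow> real"
  weight :: "'r node \<Rightarrow> real"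
  weight_scen :: "'w \<Rightarrow> 'r node \<Rightarrow> real"
  dist :: "'r node \<Rightarrow> 'r node \<Rightarrow> real"
  dist_scen :: "'w \<Rightarrow> 'r node \<Rightarrow> 'r node \<Rightarrow> real"
  penalty :: "nat \<Rightarrow> 'r \<Rightarrow> real"
  penalty_scen :: "'w \<Rightarrow> nat \<Rightarrow> 'r \<Rightarrow> real"
  arrival_epoch :: "'w \<Rightarrow> 'r \<Rightarrow> nat"
  bigM :: real
  alpha :: real
  beta :: real
  gamma :: real
  kappa :: real

definition drones :: "('r, 'w) drone_data \<Rightarrow> nat set" where
  "drones D = {1..num_drones D}"

definition cycles :: "('r, 'w) drone_data \<Rightarrow> nat set" where
  "cycles D = {1..horizon D}"

definition cycles_adhoc :: "('r, 'w) drone_data \<Rightarrow> nat set" where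
  "cycles_adhoc D = cycles D \<union> {horizon D + 1}"

definition all_requests :: "('r, 'w) drone_data \<Rightarrow> 'r set" where
  "all_requests D = existing D \<union> potential D"

definition nodes_of :: "'r set \<Rightarrow> 'r node set" where
  "nodes_of R = Req ` R \<union> {Orig, Dest}"

definition arcs_of :: "'r set \<Rightarrow> ('r node \<times> 'r node) set" where
  "arcs_of R =
     {(i, j). i \<in> Req ` R \<union> {Orig} \<and> j \<in> Req ` R \<union> {Dest} \<and> i \<noteq> j} - {(Orig, Dest)}"

text \<open>Arcs among existing requests (\<open>A\<close>) and among all requests (\<open>A\<close> with a tilde). A sum over the
  heads \<open>j\<close> (or tails \<open>i\<close>) at a request is written below as a sum over the incident arcs, so loops
  are left out.\<close>

definition arcs :: "('r, 'w) drone_data \<Rightarrow> ('r node \<times> 'r node) set" where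
  "arcs D = arcs_of (existing D)"

definition arcs_full :: "('r, 'w) drone_data \<Rightarrow> ('r node \<times> 'r node) set" where
  "arcs_full D = arcs_of (all_requests D)"

text \<open>The last two conditions say that \<open>bigM\<close> is large enough for every constraint containing it
  to be slack when its binary variable switches it off. A negative \<open>dist_scen D w Orig (Req n)\<close>
  marks request \<open>n\<close> as absent in scenario \<open>w\<close>, so distances are not assumed nonnegative.\<close>

definition drone_instance :: "('r, 'w) drone_data \<Rightarrow> bool" where
  "drone_instance D \<longleftrightarrow>
     finite (existing D) \<and> finite (potential D) \<and> existing D \<inter> potential D = {} \<and>
     finite (scenarios D) \<and> scenarios D \<noteq> {} \<and>
     weight D Dest = 0 \<and>
     (\<forall>w\<in>scenarios D. weight_scen D w Dest = 0 \<and>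
        (\<forall>m\<in>existing D. weight_scen D w (Req m) = weight D (Req m))) \<and>
     (\<forall>w\<in>scenarios D. \<forall>i\<in>nodes_of (existing D). \<forall>j\<in>nodes_of (existing D).
        dist_scen D w i j = dist D i j) \<and>
     (\<forall>w\<in>scenarios D. \<forall>n\<in>potential D. \<bar>dist_scen D w Orig (Req n)\<bar> \<le> bigM D) \<and>
     (\<forall>w\<in>scenarios D. \<forall>n\<in>potential D. \<forall>t\<in>cycles_adhoc D.
        real (arrival_epoch D w n) - real t \<le> bigM D)"

text \<open>Decision variables are total functions; their values outside the index sets occur in no
  constraint and no objective. The routing variables are indexed by drone, tail and head
  in the first stage, and by cycle, drone, tail and head in the second. The field \<open>sy\<close> holds
  both the variables of the existing and those of the potential requests.\<close>

record 'r first_stage =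
  fx :: "nat \<Rightarrow> 'r node \<Rightarrow> 'r node \<Rightarrow> real"
  fy :: "'r \<Rightarrow> real"
  fr :: "nat \<Rightarrow> real"
  fu :: "nat \<Rightarrow> 'r node \<Rightarrow> real"
  fv :: "nat \<Rightarrow> 'r node \<Rightarrow> real"

record 'r second_stage =
  sx :: "nat \<Rightarrow> nat \<Rightarrow> 'r node \<Rightarrow> 'r node \<Rightarrow> real"
  sy :: "nat \<Rightarrow> 'r \<Rightarrow> real"
  sz :: "'r \<Rightarrow> real"
  sr :: "nat \<Rightarrow> nat \<Rightarrow> real"
  su :: "nat \<Rightarrow> nat \<Rightarrow> 'r node \<Rightarrow> real"
  sv :: "nat \<Rightarrow> nat \<Rightarrow> 'r node \<Rightarrow> real"

definition first_stage_domain :: "('r, 'w) drone_data \<Rightarrow> 'r first_stage \<Rightarrow> bool" where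
  "first_stage_domain D f \<longleftrightarrow>
     (\<forall>m\<in>existing D. fy f m \<in> {0, 1}) \<and>
     (\<forall>k\<in>drones D.
        (\<forall>(i, j)\<in>arcs D. fx f k i j \<in> {0, 1}) \<and>
        fr f k \<in> {0, 1} \<and>
        (\<forall>i\<in>nodes_of (existing D). 0 \<le> fu f k i \<and> 0 \<le> fv f k i))"

definition first_stage_constraints :: "('r, 'w) drone_data \<Rightarrow> 'r first_stage \<Rightarrow> bool" where
  "first_stage_constraints D f \<longleftrightarrow>
     first_stage_domain D f \<and>
     (\<forall>k\<in>drones D. fr f k = (\<Sum>m\<in>existing D. fx f k Orig (Req m))) \<and>
     (\<forall>k\<in>drones D - {1}. fr f k \<le> fr f (k - 1)) \<and>
     (\<forall>m\<in>existing D. fy f m =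
        (\<Sum>k\<in>drones D. \<Sum>j | (Req m, j) \<in> arcs D. fx f k (Req m) j)) \<and>
     (\<forall>m\<in>existing D. \<forall>k\<in>drones D.
        (\<Sum>i | (i, Req m) \<in> arcs D. fx f k i (Req m)) =
        (\<Sum>j | (Req m, j) \<in> arcs D. fx f k (Req m) j)) \<and>
     (\<forall>(i, j)\<in>arcs D. \<forall>k\<in>drones D.
        fu f k j \<le> fu f k i - weight D j + load_cap D * (1 - fx f k i j)) \<and>
     (\<forall>k\<in>drones D. fu f k Orig \<le> load_cap D \<and> fu f k Dest = 0) \<and>
     (\<forall>(i, j)\<in>arcs D. \<forall>k\<in>drones D.
        fv f k j \<le> fv f k i - energy_rate D (fu f k i) * dist D i j
                   + battery_cap D * (1 - fx f k i j)) \<and>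
     (\<forall>k\<in>drones D. fv f k Orig = battery_cap D \<and> fv f k Dest \<ge> 0)"

definition first_stage_feasible :: "('r, 'w) drone_data \<Rightarrow> ('r \<Rightarrow> real) \<Rightarrow> bool" where
  "first_stage_feasible D y0 \<longleftrightarrow> (\<exists>f. fy f = y0 \<and> first_stage_constraints D f)"

definition first_stage_cost :: "('r, 'w) drone_data \<Rightarrow> 'r first_stage \<Rightarrow> real" where
  "first_stage_cost D f =
     alpha D * (\<Sum>m\<in>existing D. penalty D 0 m * fy f m)
     + beta D * (\<Sum>(i, j)\<in>arcs D. dist D i j * (\<Sum>k\<in>drones D. fx f k i j))
     + gamma D * (\<Sum>k\<in>drones D. fv f k Orig - fv f k Dest)
     + kappa D * (\<Sum>k\<in>drones D. fr f k)"

definition subproblem_domain :: "('r, 'w) drone_data \<Rightarrow> 'r second_stage \<Rightarrow> bool" where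
  "subproblem_domain D s \<longleftrightarrow>
     (\<forall>t\<in>cycles_adhoc D. \<forall>h\<in>all_requests D. sy s t h \<in> {0, 1}) \<and>
     (\<forall>n\<in>potential D. sz s n \<in> {0, 1}) \<and>
     (\<forall>t\<in>cycles D. \<forall>k\<in>drones D.
        (\<forall>(i, j)\<in>arcs_full D. sx s t k i j \<in> {0, 1}) \<and>
        sr s t k \<in> {0, 1} \<and>
        (\<forall>i\<in>nodes_of (all_requests D). 0 \<le> su s t k i \<and> 0 \<le> sv s t k i))"

definition subproblem_feasible ::
  "('r, 'w) drone_data \<Rightarrow> ('r \<Rightarrow> real) \<Rightarrow> 'w \<Rightarrow> 'r second_stage \<Rightarrow> bool" where
  "subproblem_feasible D y0 w s \<longleftrightarrow>
     subproblem_domain D s \<and>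
     (\<forall>m\<in>existing D. y0 m + (\<Sum>t\<in>cycles_adhoc D. sy s t m) = 1) \<and>
     (\<forall>n\<in>potential D. (\<Sum>t\<in>cycles_adhoc D. sy s t n) = 1) \<and>
     (\<forall>n\<in>potential D. \<forall>t\<in>cycles_adhoc D.
        bigM D * (1 - sy s t n) \<ge> real (arrival_epoch D w n) - real t) \<and>
     (\<forall>t\<in>cycles D. \<forall>m\<in>existing D. sy s t m =
        (\<Sum>k\<in>drones D. \<Sum>j | (Req m, j) \<in> arcs_full D. sx s t k (Req m) j)) \<and>
     (\<forall>t\<in>cycles D. \<forall>n\<in>potential D. sy s t n =
        (\<Sum>k\<in>drones D. \<Sum>j | (Req n, j) \<in> arcs_full D. sx s t k (Req n) j)
        + sz s n * of_bool (arrival_epoch D w n = t)) \<and>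
     (\<forall>n\<in>potential D. - bigM D * sz s n \<le> dist_scen D w Orig (Req n) \<and>
        dist_scen D w Orig (Req n) \<le> bigM D * (1 - sz s n)) \<and>
     (\<forall>t\<in>cycles D. \<forall>k\<in>drones D.
        sr s t k = (\<Sum>h\<in>all_requests D. sx s t k Orig (Req h))) \<and>
     (\<forall>t\<in>cycles D. \<forall>k\<in>drones D - {1}. sr s t k \<le> sr s t (k - 1)) \<and>
     (\<forall>t\<in>cycles D. \<forall>k\<in>drones D. \<forall>h\<in>all_requests D.
        (\<Sum>i | (i, Req h) \<in> arcs_full D. sx s t k i (Req h)) =
        (\<Sum>j | (Req h, j) \<in> arcs_full D. sx s t k (Req h) j)) \<and>
     (\<forall>t\<in>cycles D. \<forall>k\<in>drones D. \<forall>(i, j)\<in>arcs_full D.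
        su s t k j \<le> su s t k i - weight_scen D w j + load_cap D * (1 - sx s t k i j)) \<and>
     (\<forall>t\<in>cycles D. \<forall>k\<in>drones D. su s t k Orig \<le> load_cap D \<and> su s t k Dest = 0) \<and>
     (\<forall>t\<in>cycles D. \<forall>k\<in>drones D. \<forall>(i, j)\<in>arcs_full D.
        sv s t k j \<le> sv s t k i - energy_rate D (su s t k i) * dist_scen D w i j
                     + battery_cap D * (1 - sx s t k i j)) \<and>
     (\<forall>t\<in>cycles D. \<forall>k\<in>drones D. sv s t k Orig = battery_cap D \<and> sv s t k Dest \<ge> 0)"

definition subproblem_cost ::
  "('r, 'w) drone_data \<Rightarrow> 'w \<Rightarrow> 'r second_stage \<Rightarrow> real" where
  "subproblem_cost D w s =
     alpha D * (\<Sum>t\<in>cycles_adhoc D.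
        (\<Sum>m\<in>existing D. penalty D t m * sy s t m)
        + (\<Sum>n\<in>potential D. penalty_scen D w t n * sy s t n))
     + (\<Sum>t\<in>cycles D.
          beta D * (\<Sum>(i, j)\<in>arcs_full D. dist_scen D w i j * (\<Sum>k\<in>drones D. sx s t k i j))
          + gamma D * (\<Sum>k\<in>drones D. sv s t k Orig - sv s t k Dest)
          + kappa D * (\<Sum>k\<in>drones D. sr s t k))"

text \<open>The infimum is the minimum whenever the latter is attained. If every first-stage feasible
  \<open>y0\<close> has feasible subproblems and the extensive form has an optimal solution, then the set of
  costs is nonempty and bounded below for every such \<open>y0\<close> and every scenario, so the \<open>Inf\<close> below
  is a genuine infimum there.\<close>

definition subproblem_value :: "('r, 'w) drone_data \<Rightarrow> ('r \<Rightarrow> real) \<Rightarrow> 'w \<Rightarrow> real" where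
  "subproblem_value D y0 w = Inf (subproblem_cost D w ` {s. subproblem_feasible D y0 w s})"

definition recourse :: "('r, 'w) drone_data \<Rightarrow> ('r \<Rightarrow> real) \<Rightarrow> real" where
  "recourse D y0 = 1 / real (card (scenarios D)) * (\<Sum>w\<in>scenarios D. subproblem_value D y0 w)"

text \<open>The extensive form: first-stage variables together with second-stage variables for every
  scenario.\<close>

definition ef_feasible ::
  "('r, 'w) drone_data \<Rightarrow> 'r first_stage \<times> ('w \<Rightarrow> 'r second_stage) \<Rightarrow> bool" where
  "ef_feasible D = (\<lambda>(f, s). first_stage_constraints D f \<and>
     (\<forall>w\<in>scenarios D. subproblem_feasible D (fy f) w (s w)))"

definition ef_cost ::
  "('r, 'w) drone_data \<Rightarrow> 'r first_stage \<times> ('w \<Rightarrow> 'r second_stage) \<Rightarrow> real" where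
  "ef_cost D = (\<lambda>(f, s). first_stage_cost D f
     + 1 / real (card (scenarios D)) * (\<Sum>w\<in>scenarios D. subproblem_cost D w (s w)))"

definition ef_optimal ::
  "('r, 'w) drone_data \<Rightarrow> 'r first_stage \<times> ('w \<Rightarrow> 'r second_stage) \<Rightarrow> bool" where
  "ef_optimal D p \<longleftrightarrow> ef_feasible D p \<and> (\<forall>p'. ef_feasible D p' \<longrightarrow> ef_cost D p \<le> ef_cost D p')"

text \<open>An inequality in \<open>(y0, \<theta>)\<close> is given as the predicate of the points satisfying it.\<close>

definition valid_optimality_cut ::
  "('r, 'w) drone_data \<Rightarrow> (('r \<Rightarrow> real) \<Rightarrow> real \<Rightarrow> bool) \<Rightarrow> bool" where
  "valid_optimality_cut D C \<longleftrightarrow> (\<forall>f s. ef_optimal D (f, s) \<longrightarrow> C (fy f) (recourse D (fy f)))"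

end

theory Submission
  imports Defs
begin

text \<open>The right-hand side of the cut is an affine function of the Hamming distance \<open>h\<close> between the
  binary vector \<open>y0\<close> and the indicator of \<open>S\<close>: since
  \<open>(\<Sum>m\<in>S. y0 m) - (\<Sum>m\<in>existing D - S. y0 m) = card S - h\<close>
  (lemma \<open>sum_diff_eq_card_minus_hamming\<close>), it equals
  \<open>L + (recourse D y_eta - L) * (1 - h)\<close>. At \<open>h = 0\<close> the vector \<open>y0\<close> agrees with \<open>y_eta\<close> on the
  existing requests, which are the only entries that the subproblems see
  (lemma \<open>recourse_cong\<close>), so the cut holds with equality. At \<open>h \<ge> 1\<close> the factor \<open>1 - h\<close> is
  nonpositive while \<open>recourse D y_eta - L\<close> is nonnegative, so the right-hand side is at most \<open>L\<close>,
  a lower bound on the recourse. Thus the cut holds at every first-stage feasible point,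
  and in particular at the optimal ones.\<close>

text \<open>An element of \<open>S\<close> with \<open>y m = 0\<close> is missing from the first sum, and an element outside \<open>S\<close>
  with \<open>y m = 1\<close> is subtracted by the second, so each mismatch lowers the difference by one from
  its largest possible value \<open>card S\<close>.\<close>

lemma sum_diff_eq_card_minus_hamming:
  fixes y :: "'a \<Rightarrow> real"
  assumes fin: "finite M" and sub: "S \<subseteq> M" and bin: "\<And>m. m \<in> M \<Longrightarrow> y m \<in> {0, 1}"
  shows "(\<Sum>m\<in>S. y m) - (\<Sum>m\<in>M - S. y m)
    = real (card S) - real (card {m \<in> M. y m \<noteq> of_bool (m \<in> S)})"
proof -
  have "(\<Sum>m\<in>S. y m) = (\<Sum>m\<in>S. 1 - of_bool (y m \<noteq> of_bool (m \<in> S)))"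
    using sub bin by (intro sum.cong) auto
  moreover have "(\<Sum>m\<in>M - S. y m) = (\<Sum>m\<in>M - S. of_bool (y m \<noteq> of_bool (m \<in> S)))"
    using bin by (intro sum.cong) auto
  moreover have "real (card {m \<in> M. y m \<noteq> of_bool (m \<in> S)})
      = (\<Sum>m\<in>M. of_bool (y m \<noteq> of_bool (m \<in> S)))"
    using fin by (simp add: Int_def)
  ultimately show ?thesis
    using sum.subset_diff[OF sub fin, of "\<lambda>m. of_bool (y m \<noteq> of_bool (m \<in> S)) :: real"]
    by (simp add: sum_subtractf)
qed

text \<open>First-stage feasible vectors are total functions, unconstrained outside the existing requests;
  equality of two such vectors is therefore only ever known on \<open>existing D\<close>, and the recourse
  has to be compared under this weaker hypothesis.\<close>

lemma recourse_cong:
  assumes "\<And>m. m \<in> existing D \<Longrightarrow> y m = y' m"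
  shows "recourse D y = recourse D y'"
proof -
  have "subproblem_feasible D y w s = subproblem_feasible D y' w s" for w s
    unfolding subproblem_feasible_def using assms by simp
  then show ?thesis
    by (simp add: recourse_def subproblem_value_def)
qed

lemma first_stage_feasible_binary:
  assumes "first_stage_feasible D y" and "m \<in> existing D"
  shows "y m \<in> {0, 1}"
  using assms
  by (auto simp: first_stage_feasible_def first_stage_constraints_def first_stage_domain_def)

theorem proposition1:
  fixes D :: "('r, 'w) drone_data" and L :: real and y_eta :: "'r \<Rightarrow> real" and S :: "'r set"
  assumes inst: "drone_instance D"
    and subproblem_feas: "\<And>y0 w. first_stage_feasible D y0 \<Longrightarrow> w \<in> scenarios D \<Longrightarrow>
          \<exists>s. subproblem_feasible D y0 w s"
    and lower_bound: "\<And>y0. first_stage_feasible D y0 \<Longrightarrow> L \<le> recourse D y0"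
    and y_eta: "first_stage_feasible D y_eta"
    and S: "S = {m \<in> existing D. y_eta m = 1}"
  shows "valid_optimality_cut D (\<lambda>y0 \<theta>.
           \<theta> \<ge> (recourse D y_eta - L) * ((\<Sum>m\<in>S. y0 m) - (\<Sum>m\<in>existing D - S. y0 m))
               - (recourse D y_eta - L) * (real (card S) - 1) + L)"
  unfolding valid_optimality_cut_def
proof (intro allI impI)
  fix f :: "'r first_stage" and s :: "'w \<Rightarrow> 'r second_stage"
  assume "ef_optimal D (f, s)"
  then have feas: "first_stage_feasible D (fy f)"
    by (auto simp: ef_optimal_def ef_feasible_def first_stage_feasible_def)
  have fin: "finite (existing D)"
    using inst by (simp add: drone_instance_def)
  define H where "H = {m \<in> existing D. fy f m \<noteq> of_bool (m \<in> S)}"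
  have "(\<Sum>m\<in>S. fy f m) - (\<Sum>m\<in>existing D - S. fy f m) = real (card S) - real (card H)"
    unfolding H_def using fin S first_stage_feasible_binary[OF feas]
    by (intro sum_diff_eq_card_minus_hamming) auto
  then have rhs: "(recourse D y_eta - L) * ((\<Sum>m\<in>S. fy f m) - (\<Sum>m\<in>existing D - S. fy f m))
      - (recourse D y_eta - L) * (real (card S) - 1) + L
      = L + (recourse D y_eta - L) * (1 - real (card H))"
    by (simp only:) (simp add: algebra_simps)
  have "L + (recourse D y_eta - L) * (1 - real (card H)) \<le> recourse D (fy f)"
  proof (cases "H = {}")
    case True
    have "fy f m = y_eta m" if "m \<in> existing D" for m
      using True that first_stage_feasible_binary[OF y_eta that] by (auto simp: H_def S)
    then have "recourse D (fy f) = recourse D y_eta"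
      by (rule recourse_cong)
    with True show ?thesis by simp
  next
    case False
    then have "1 \<le> card H"
      using fin by (simp add: H_def Suc_le_eq card_gt_0_iff)
    then have "(recourse D y_eta - L) * (1 - real (card H)) \<le> 0"
      using lower_bound[OF y_eta] by (intro mult_nonneg_nonpos) auto
    with lower_bound[OF feas] show ?thesis by simp
  qed
  with rhs show "(recourse D y_eta - L) * ((\<Sum>m\<in>S. fy f m) - (\<Sum>m\<in>existing D - S. fy f m))
      - (recourse D y_eta - L) * (real (card S) - 1) + L \<le> recourse D (fy f)"
    by simp
qed

end
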